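(* Let $k>1$ be an integer. For any rational number $q$ where $k/2 \leq q \leq 2k-1$, there exists a weighted $k$-majority tournament $T$ such that $\gamma_w(T) = q$.
   Context: Let $k \ge 1$ be an integer and let $V$ be a finite nonempty set. Linear orders on $V$ are strict total orders. A $k$-majority tournament $T$ with vertex set $V(T)=V$ is defined by a list of $2k-1$ (not necessarily distinct) linear orders on $V$: for distinct $u,v\in V$ there is a directed edge $u\to v$ in $T$ if and only if $u>v$ in at least $k$ of the $2k-1$ orders. A weighted $k$-majority tournament is a $k$-majority tournament (with its defining orders) in which each edge $u\to v$ carries the weight $w(u\to v)$ equal to the number of the $2k-1$ orders in which $u>v$ (so $k\le w(u\to v)\le 2k-1$). A dominating set of $T$ is a set $D\subseteq V(T)$ such that for every $v\in V(T)\setminus D$ there is $u\in D$ with $u\to v$. (In particular $D\neq\emptyset$, since $V\ne\emptyset$.) For a dominating set $D$ and a vertex $v$, the average inweight of $v$ with respect to $D$ is $$w_a(v,D)=\frac{1}{|D|}\sum_{u\in D,\ u\to v} w(u\to v),$$ and the weight (approval gap) of $D$ on $T$ is $W(T,D)=\min_{v\in V(T)\setminus D} w_a(v,D)$ if $D\neq V(T)$, and $W(T,D)=0$ if $D=V(T)$. The maximum approval gap of $T$ is $\gamma_w(T)=\max_D W(T,D)$, the maximum being over all dominating sets $D$ of $T$. *)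

theory Defs
  imports Complex_Main
begin

(* A pair (u, v) in a relation r of the list is read as u < v, as in strict_linear_order_on. *)

locale weighted_majority_tournament =
  fixes k :: nat and V :: "'a set" and orders :: "'a rel list"
  assumes k_pos: "k \<ge> 1"
    and finite_V: "finite V"
    and V_nonempty: "V \<noteq> {}"
    and length_orders: "length orders = 2 * k - 1"
    and orders_on: "\<And>r. r \<in> set orders \<Longrightarrow> r \<subseteq> V \<times> V \<and> strict_linear_order_on V r"
begin

definition weight :: "'a \<Rightarrow> 'a \<Rightarrow> nat" where
  "weight u v = length (filter (\<lambda>r. (v, u) \<in> r) orders)"

definition edge :: "'a \<Rightarrow> 'a \<Rightarrow> bool" where
  "edge u v \<longleftrightarrow> u \<in> V \<and> v \<in> V \<and> u \<noteq> v \<and> weight u v \<ge> k"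

definition dominating_set :: "'a set \<Rightarrow> bool" where
  "dominating_set D \<longleftrightarrow> D \<subseteq> V \<and> (\<forall>v \<in> V - D. \<exists>u \<in> D. edge u v)"

definition avg_inweight :: "'a \<Rightarrow> 'a set \<Rightarrow> real" where
  "avg_inweight v D = (\<Sum>u \<in> {u \<in> D. edge u v}. real (weight u v)) / real (card D)"

definition approval_gap :: "'a set \<Rightarrow> real" where
  "approval_gap D = (if D = V then 0 else Min ((\<lambda>v. avg_inweight v D) ` (V - D)))"

(* Min and Max range over finite nonempty sets here: V is finite, and V dominates itself. *)
definition max_approval_gap :: real where
  "max_approval_gap = Max (approval_gap ` {D. dominating_set D})"

end

end

theory Submission
  imports Defs
begin

text \<open>
  Take vertices \<open>0, \<dots>, n - 1\<close> carrying a tournament all of whose edges have the least possible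
  weight \<open>k\<close>, and one further vertex \<open>n\<close>. The weights of the edges at \<open>n\<close> are chosen such that the
  dominating set \<open>{..<n}\<close>, which misses only \<open>n\<close>, has approval gap exactly \<open>q\<close>: since \<open>q\<close> is rational, a
  suitable \<open>n\<close> makes \<open>q * n\<close> a sum of admissible integer weights. Every other proper dominating set \<open>D\<close>
  misses an old vertex, and all edges into an old vertex have weight \<open>k\<close>. So the average inweight of an
  old vertex \<open>x\<close> is \<open>k\<close> times the fraction of \<open>D\<close> that beats \<open>x\<close>. It is at most \<open>k\<close>, which settles
  \<open>q \<ge> k\<close> for any choice of the old tournament.

  For \<open>k / 2 < q < k\<close> the old tournament is chosen nearly regular. In a regular tournament a set \<open>D\<close>
  sends on average half of the possible edges to the vertices outside, so some old vertex outside
  \<open>D\<close> is beaten by at most about half of \<open>D\<close>; the lemma \<open>ex_rarely_beaten\<close> makes this precise, with an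
  error term of order \<open>1 / n\<close> that accounts for the irregularity and for the vertex \<open>n\<close>. For large \<open>n\<close> the
  error is absorbed by the slack \<open>q / k - 1 / 2 > 0\<close>. For \<open>q = k / 2\<close> there is no slack, and the cyclic
  triangle is used directly.

  Nearly regular tournaments of arbitrarily large order, and of an order with prescribed divisors,
  come from iterated substitution: replacing each vertex of a cyclic triangle by a copy of a
  tournament leaves the deviation of the out-degrees from regularity unchanged (\<open>triple_blocks\<close>).
  These tournaments are realised by three rankings that split every pair two to one, and adding
  \<open>k - 2\<close> pairs of opposite orders turns the split into \<open>k\<close> to \<open>k - 1\<close> (\<open>paired_ranks_count\<close>).
\<close>

section \<open>Edges leaving a set in a nearly regular tournament\<close>

lemma sum_of_bool_within_tournament:
  fixes R :: "'a \<Rightarrow> 'a \<Rightarrow> bool"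
  assumes "finite D" and "\<And>x y. x \<in> D \<Longrightarrow> y \<in> D \<Longrightarrow> x \<noteq> y \<Longrightarrow> R x y \<longleftrightarrow> \<not> R y x"
    and "\<And>x. x \<in> D \<Longrightarrow> \<not> R x x"
  shows "2 * (\<Sum>x\<in>D. \<Sum>y\<in>D. of_bool (R x y) :: real) = real (card D) * (real (card D) - 1)"
proof -
  have "2 * (\<Sum>x\<in>D. \<Sum>y\<in>D. of_bool (R x y) :: real)
      = (\<Sum>x\<in>D. \<Sum>y\<in>D. of_bool (R x y)) + (\<Sum>x\<in>D. \<Sum>y\<in>D. of_bool (R y x))"
    using sum.swap[of "\<lambda>x y. of_bool (R x y) :: real" D D] by simp
  also have "\<dots> = (\<Sum>x\<in>D. \<Sum>y\<in>D. 1 - of_bool (x = y))"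
    unfolding sum.distrib[symmetric]
  proof (intro sum.cong refl)
    fix x y assume "x \<in> D" "y \<in> D"
    then show "of_bool (R x y) + of_bool (R y x) = (1 - of_bool (x = y) :: real)"
      using assms(2)[of x y] assms(3)[of x] by (cases "x = y"; cases "R x y") simp_all
  qed
  also have "\<dots> = (\<Sum>x\<in>D. real (card D) - 1)"
    by (intro sum.cong refl) (use assms(1) in \<open>simp add: sum_subtractf of_bool_def\<close>)
  finally show ?thesis by simp
qed

text \<open>The out-degrees of the vertices in \<open>D\<close> also count the edges inside \<open>D\<close>, whose number is
  determined by the size of \<open>D\<close>; what remains leaves \<open>D\<close>. This is the better bound for small \<open>D\<close>.\<close>

lemma edges_leaving_le:
  fixes R :: "'a \<Rightarrow> 'a \<Rightarrow> bool" and c :: real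
  assumes "finite S" "D \<subseteq> S"
    and "\<And>x y. x \<in> S \<Longrightarrow> y \<in> S \<Longrightarrow> x \<noteq> y \<Longrightarrow> R x y \<longleftrightarrow> \<not> R y x"
    and "\<And>x. x \<in> S \<Longrightarrow> \<not> R x x"
    and out: "\<And>x. x \<in> S \<Longrightarrow> 2 * (\<Sum>y\<in>S. of_bool (R x y)) \<le> real (card S) - 1 + c"
  shows "2 * (\<Sum>x\<in>D. \<Sum>y\<in>S - D. of_bool (R x y)) \<le> real (card D) * (real (card S) - real (card D) + c)"
proof -
  have fin: "finite D" using assms finite_subset by blast
  have "(\<Sum>x\<in>D. \<Sum>y\<in>S. of_bool (R x y) :: real)
      = (\<Sum>x\<in>D. \<Sum>y\<in>S - D. of_bool (R x y)) + (\<Sum>x\<in>D. \<Sum>y\<in>D. of_bool (R x y))"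
    unfolding sum.distrib[symmetric]
    using assms(1,2) by (intro sum.cong refl sum.subset_diff)
  moreover have "2 * (\<Sum>x\<in>D. \<Sum>y\<in>D. of_bool (R x y) :: real) = real (card D) * (real (card D) - 1)"
    using assms(2) by (intro sum_of_bool_within_tournament fin assms(3,4)) auto
  moreover have "2 * (\<Sum>x\<in>D. \<Sum>y\<in>S. of_bool (R x y) :: real) \<le> (\<Sum>x\<in>D. real (card S) - 1 + c)"
    unfolding sum_distrib_left[of 2 _ D] using out assms(2) by (intro sum_mono) blast
  ultimately show ?thesis by (simp add: algebra_simps)
qed

text \<open>The same count for the reversed tournament and the complement of \<open>D\<close>, which is better
  when \<open>D\<close> is large.\<close>

lemma edges_leaving_le_complement:
  fixes R :: "'a \<Rightarrow> 'a \<Rightarrow> bool" and c :: real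
  assumes "finite S" "D \<subseteq> S"
    and asym: "\<And>x y. x \<in> S \<Longrightarrow> y \<in> S \<Longrightarrow> x \<noteq> y \<Longrightarrow> R x y \<longleftrightarrow> \<not> R y x"
    and irrefl: "\<And>x. x \<in> S \<Longrightarrow> \<not> R x x"
    and out: "\<And>x. x \<in> S \<Longrightarrow> real (card S) - 1 - c \<le> 2 * (\<Sum>y\<in>S. of_bool (R x y))"
  shows "2 * (\<Sum>x\<in>D. \<Sum>y\<in>S - D. of_bool (R x y))
    \<le> (real (card S) - real (card D)) * (real (card D) + c)"
proof -
  have cd: "real (card (S - D)) = real (card S) - real (card D)"
    using assms(1,2) by (simp add: card_Diff_subset finite_subset card_mono of_nat_diff)
  have "2 * (\<Sum>y\<in>S. of_bool (R y x)) \<le> real (card S) - 1 + c" if x: "x \<in> S" for x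
  proof -
    have "(\<Sum>y\<in>S. of_bool (R x y) :: real) + (\<Sum>y\<in>S. of_bool (R y x)) = (\<Sum>y\<in>S. 1 - of_bool (x = y))"
      unfolding sum.distrib[symmetric]
    proof (intro sum.cong refl)
      fix y assume "y \<in> S"
      then show "of_bool (R x y) + of_bool (R y x) = (1 - of_bool (x = y) :: real)"
        using asym[of x y] irrefl[of x] x by (cases "x = y"; cases "R x y") simp_all
    qed
    also have "\<dots> = real (card S) - 1"
      using x assms(1) by (simp add: sum_subtractf of_bool_def)
    finally show ?thesis using out[OF x] by linarith
  qed
  then have "2 * (\<Sum>x\<in>S - D. \<Sum>y\<in>S - (S - D). of_bool (R y x))
    \<le> real (card (S - D)) * (real (card S) - real (card (S - D)) + c)"
    using assms(1) asym irrefl by (intro edges_leaving_le) blast+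
  moreover have "S - (S - D) = D" using assms(2) by blast
  ultimately show ?thesis
    using cd sum.swap[of "\<lambda>x y. of_bool (R x y) :: real" "S - D" D] by simp
qed

lemma ex_le_average:
  fixes f :: "'a \<Rightarrow> real"
  assumes "finite A" "A \<noteq> {}" "sum f A \<le> real (card A) * M"
  shows "\<exists>x\<in>A. f x \<le> M"
proof (rule ccontr)
  assume "\<not> ?thesis"
  then have "(\<Sum>x\<in>A. M) < sum f A"
    using assms by (intro sum_strict_mono) (auto simp: not_le)
  then show False using assms by simp
qed

text \<open>The set \<open>H\<close> and the number \<open>\<tau>\<close> model an additional vertex outside \<open>S\<close> that beats exactly the
  vertices in \<open>H\<close>: \<open>\<tau>\<close> is 1 if that vertex belongs to the dominating set and 0 otherwise. The vertex \<open>x\<close>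
  is found by averaging over \<open>S - D\<close>. The excess over one half is at most \<open>(c + \<tau>) * min d (n - d) / 2\<close>
  in total, where \<open>d\<close> and \<open>n\<close> are the sizes of \<open>D\<close> and \<open>S\<close>, and \<open>min d (n - d) * n \<le> 2 * d * (n - d)\<close>.\<close>

lemma ex_rarely_beaten:
  fixes R :: "'a \<Rightarrow> 'a \<Rightarrow> bool" and c e \<tau> :: real
  assumes "finite S" "D \<subset> S"
    and asym: "\<And>x y. x \<in> S \<Longrightarrow> y \<in> S \<Longrightarrow> x \<noteq> y \<Longrightarrow> R x y \<longleftrightarrow> \<not> R y x"
    and irrefl: "\<And>x. x \<in> S \<Longrightarrow> \<not> R x x"
    and bal: "\<And>x. x \<in> S \<Longrightarrow> \<bar>2 * (\<Sum>y\<in>S. of_bool (R x y)) - (real (card S) - 1)\<bar> \<le> c"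
    and H: "H \<subseteq> S" "2 * card H \<le> card S"
    and \<tau>: "0 \<le> \<tau>" "\<tau> \<le> 1" and e: "c + \<tau> \<le> e * real (card S)" "0 \<le> e"
  shows "\<exists>x\<in>S - D. (\<Sum>y\<in>D. of_bool (R y x)) + \<tau> * of_bool (x \<in> H)
           \<le> (1 / 2 + e) * (real (card D) + \<tau>)"
proof (rule ex_le_average)
  show "finite (S - D)" "S - D \<noteq> {}" using assms by auto
  define n d where "n = real (card S)" and "d = real (card D)"
  have dn: "d < n" unfolding n_def d_def using assms(1,2) by (simp add: psubset_card_mono)
  have cd: "real (card (S - D)) = n - d"
    unfolding n_def d_def using assms(1) psubset_imp_subset[OF assms(2)]
    by (simp add: card_Diff_subset finite_subset card_mono of_nat_diff)
  define X where "X = (\<Sum>x\<in>S - D. \<Sum>y\<in>D. of_bool (R y x) :: real)"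
  have X: "X = (\<Sum>x\<in>D. \<Sum>y\<in>S - D. of_bool (R x y))"
    unfolding X_def by (rule sum.swap)
  have bal_ub: "2 * (\<Sum>y\<in>S. of_bool (R x y)) \<le> real (card S) - 1 + c"
    and bal_lb: "real (card S) - 1 - c \<le> 2 * (\<Sum>y\<in>S. of_bool (R x y))" if "x \<in> S" for x
    using bal[OF that] by linarith+
  have X1: "2 * X \<le> d * (n - d + c)"
    unfolding X n_def d_def
    by (intro edges_leaving_le assms(1) psubset_imp_subset[OF assms(2)] asym irrefl bal_ub)
  have X2: "2 * X \<le> (n - d) * (d + c)"
    unfolding X n_def d_def
    by (intro edges_leaving_le_complement assms(1) psubset_imp_subset[OF assms(2)] asym irrefl bal_lb)
  define h where "h = (\<Sum>x\<in>S - D. of_bool (x \<in> H) :: real)"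
  have h: "h = real (card ((S - D) \<inter> H))"
    unfolding h_def using assms(1) by (simp add: of_bool_def sum.If_cases)
  have h1: "h \<le> n - d"
    unfolding h cd[symmetric] using assms(1) by (simp add: card_mono)
  have "card ((S - D) \<inter> H) \<le> card H" using H assms(1) by (intro card_mono) (auto dest: finite_subset)
  then have h2: "2 * h \<le> n" unfolding h n_def using H(2) by linarith
  have d0: "0 \<le> d" by (simp add: d_def)
  have "X + \<tau> * h \<le> (n - d) * ((1 / 2 + e) * (d + \<tau>))"
  proof (cases "2 * d \<le> n")
    case True
    have "\<tau> * (2 * h) \<le> \<tau> * n" using \<tau> h2 by (intro mult_left_mono) auto
    then have "2 * (X + \<tau> * h) \<le> (n - d) * (d + \<tau>) + (c + \<tau>) * d"
      using X1 by (simp add: algebra_simps)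
    moreover have "(c + \<tau>) * d \<le> (e * n) * d"
      using e(1) d0 by (intro mult_right_mono) (auto simp: n_def)
    moreover have "(e * d) * n \<le> (e * d) * (2 * (n - d))"
      using True e d0 by (intro mult_left_mono) auto
    moreover have "0 \<le> e * (n - d) * \<tau>" using e \<tau> dn by simp
    ultimately show ?thesis by (simp add: algebra_simps add_divide_distrib diff_divide_distrib)
  next
    case False
    have "\<tau> * h \<le> \<tau> * (n - d)" using \<tau> h1 by (intro mult_left_mono) auto
    then have "2 * (X + \<tau> * h) \<le> (n - d) * (d + \<tau>) + (n - d) * (c + \<tau>)"
      using X2 by (simp add: algebra_simps)
    moreover have "(n - d) * (c + \<tau>) \<le> (n - d) * (e * n)"
      using e(1) dn by (intro mult_left_mono) (auto simp: n_def)
    moreover have "(e * (n - d)) * n \<le> (e * (n - d)) * (2 * d)"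
      using False e dn by (intro mult_left_mono) auto
    moreover have "0 \<le> e * (n - d) * \<tau>" using e \<tau> dn by simp
    ultimately show ?thesis by (simp add: algebra_simps add_divide_distrib diff_divide_distrib)
  qed
  then show "(\<Sum>x\<in>S - D. (\<Sum>y\<in>D. of_bool (R y x)) + \<tau> * of_bool (x \<in> H))
      \<le> real (card (S - D)) * ((1 / 2 + e) * (real (card D) + \<tau>))"
    unfolding cd d_def[symmetric] sum.distrib sum_distrib_left[symmetric] X_def[symmetric] h_def[symmetric] .
qed

section \<open>Triples of rankings with a nearly regular majority\<close>

text \<open>The majority relation of three rankings of the natural numbers, the first of which is the
  identity; the larger rank wins.\<close>

definition majority_beats :: "(nat \<Rightarrow> nat) \<Rightarrow> (nat \<Rightarrow> nat) \<Rightarrow> nat \<Rightarrow> nat \<Rightarrow> bool" where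
  "majority_beats g1 g2 x y \<longleftrightarrow>
     y < x \<and> g1 y < g1 x \<or> y < x \<and> g2 y < g2 x \<or> g1 y < g1 x \<and> g2 y < g2 x"

text \<open>No pair is ranked unanimously by the identity, \<open>g1\<close> and \<open>g2\<close>, so every pair is decided two to one.
  Applied to both \<open>(x, y)\<close> and \<open>(y, x)\<close>, the last condition excludes unanimity in either direction.\<close>

definition split_ranking :: "nat \<Rightarrow> (nat \<Rightarrow> nat) \<Rightarrow> (nat \<Rightarrow> nat) \<Rightarrow> bool" where
  "split_ranking n g1 g2 \<longleftrightarrow>
     inj_on g1 {..<n} \<and> inj_on g2 {..<n} \<and> g1 ` {..<n} \<subseteq> {..<n} \<and> g2 ` {..<n} \<subseteq> {..<n} \<and>
     (\<forall>x<n. \<forall>y<n. \<not> (y < x \<and> g1 y < g1 x \<and> g2 y < g2 x))"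

text \<open>In a regular tournament on \<open>n\<close> vertices every out-degree is \<open>(n - 1) / 2\<close>.\<close>

definition balanced_upto :: "nat \<Rightarrow> nat \<Rightarrow> (nat \<Rightarrow> nat) \<Rightarrow> (nat \<Rightarrow> nat) \<Rightarrow> bool" where
  "balanced_upto c n g1 g2 \<longleftrightarrow>
     (\<forall>x<n. \<bar>2 * (\<Sum>y<n. of_bool (majority_beats g1 g2 x y)) - (real n - 1)\<bar> \<le> real c)"

lemma less_block_iff:
  fixes a b n u v :: nat
  assumes "u < n" "v < n"
  shows "a * n + u < b * n + v \<longleftrightarrow> a < b \<or> a = b \<and> u < v"
proof -
  have "a * n + u < b * n + v" if "a < b"
  proof -
    have "a * n + u < Suc a * n" using assms by simp
    also have "\<dots> \<le> b * n" using that by (intro mult_le_mono1) simp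
    finally show ?thesis by simp
  qed
  moreover have "b * n + v < a * n + u" if "b < a"
  proof -
    have "b * n + v < Suc b * n" using assms by simp
    also have "\<dots> \<le> a * n" using that by (intro mult_le_mono1) simp
    finally show ?thesis by simp
  qed
  ultimately show ?thesis by (cases a b rule: linorder_cases) force+
qed

text \<open>Three consecutive blocks of length \<open>n\<close> are shifted cyclically by \<open>j\<close> places, and each of them is
  ranked by \<open>g\<close>.\<close>

definition rotate_blocks :: "nat \<Rightarrow> nat \<Rightarrow> (nat \<Rightarrow> nat) \<Rightarrow> nat \<Rightarrow> nat" where
  "rotate_blocks j n g x = ((x div n + j) mod 3) * n + g (x mod n)"

lemma rotate_blocks_block:
  assumes "x < n"
  shows "rotate_blocks j n g (a * n + x) = ((a + j) mod 3) * n + g x"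
  using assms by (simp add: rotate_blocks_def)

lemma block_cases:
  fixes n x :: nat
  assumes "x < 3 * n"
  obtains a u where "a < 3" "u < n" "x = a * n + u"
proof
  have "n > 0" using assms by (cases n) auto
  then show "x mod n < n" by simp
  show "x div n < 3" using assms by (simp add: less_mult_imp_div_less)
  show "x = (x div n) * n + x mod n" by simp
qed

lemma lt3: "(a::nat) < 3 \<longleftrightarrow> a = 0 \<or> a = 1 \<or> a = 2" by linarith

lemma rotate_mod3_inj:
  fixes a b j :: nat
  assumes "a < 3" "b < 3" "j < 3" "(a + j) mod 3 = (b + j) mod 3"
  shows "a = b"
  using assms unfolding lt3 by (elim disjE) simp_all

lemma rotate_blocks_inj:
  assumes "inj_on g {..<n}" "g ` {..<n} \<subseteq> {..<n}" "j < 3"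
  shows "inj_on (rotate_blocks j n g) {..<3 * n}"
    and "rotate_blocks j n g ` {..<3 * n} \<subseteq> {..<3 * n}"
proof -
  show "inj_on (rotate_blocks j n g) {..<3 * n}"
  proof (rule inj_onI)
    fix x y assume "x \<in> {..<3 * n}" "y \<in> {..<3 * n}" and eq: "rotate_blocks j n g x = rotate_blocks j n g y"
    then have xy: "x < 3 * n" "y < 3 * n" by simp_all
    obtain a u where x: "a < 3" "u < n" "x = a * n + u" using xy(1) by (rule block_cases)
    obtain b v where y: "b < 3" "v < n" "y = b * n + v" using xy(2) by (rule block_cases)
    have g: "g u < n" "g v < n" using assms(2) x(2) y(2) by auto
    have e: "((a + j) mod 3) * n + g u = ((b + j) mod 3) * n + g v"
      using eq x y by (simp add: rotate_blocks_block)
    then have "\<not> (a + j) mod 3 * n + g u < (b + j) mod 3 * n + g v"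
      "\<not> (b + j) mod 3 * n + g v < (a + j) mod 3 * n + g u" by simp_all
    then have "(a + j) mod 3 = (b + j) mod 3 \<and> g u = g v"
      unfolding less_block_iff[OF g] less_block_iff[OF g(2,1)] by linarith
    moreover have "a = b" if "(a + j) mod 3 = (b + j) mod 3"
      using x(1) y(1) assms(3) that by (rule rotate_mod3_inj)
    moreover have "u = v" if "g u = g v"
      using that assms(1) x y by (simp add: inj_on_def)
    ultimately show "x = y" using x y by simp
  qed
  show "rotate_blocks j n g ` {..<3 * n} \<subseteq> {..<3 * n}"
  proof clarify
    fix x assume "x < 3 * n"
    then obtain a u where x: "a < 3" "u < n" "x = a * n + u" by (rule block_cases)
    have "g u < n" using assms(2) x(2) by auto
    moreover have "(a + j) mod 3 < 3" by simp
    ultimately have "((a + j) mod 3) * n + g u < 3 * n + 0"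
      by (subst less_block_iff) (use x(2) in auto)
    then show "rotate_blocks j n g x < 3 * n" using x by (simp add: rotate_blocks_block)
  qed
qed

text \<open>The shifts by 0, 1 and 2 form a Condorcet cycle: block \<open>a\<close> beats block \<open>b\<close> iff
  \<open>a = (b + 1) mod 3\<close>. A vertex beats all \<open>n\<close> vertices of exactly one other block, so its doubled
  out-degree grows by \<open>2 * n\<close>, just as the number of vertices does.\<close>

lemma triple_blocks:
  fixes g1 g2 n
  defines "G1 \<equiv> rotate_blocks 1 n g1" and "G2 \<equiv> rotate_blocks 2 n g2"
  assumes S: "split_ranking n g1 g2" and B: "balanced_upto c n g1 g2"
  shows "split_ranking (3 * n) G1 G2" and "balanced_upto c (3 * n) G1 G2"
proof -
  have r: "g1 u < n" "g2 u < n" if "u < n" for u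
    using S that unfolding split_ranking_def by auto
  have less: "G1 (a * n + u) < G1 (b * n + v) \<longleftrightarrow> (a + 1) mod 3 < (b + 1) mod 3 \<or> (a + 1) mod 3 = (b + 1) mod 3 \<and> g1 u < g1 v"
       "G2 (a * n + u) < G2 (b * n + v) \<longleftrightarrow> (a + 2) mod 3 < (b + 2) mod 3 \<or> (a + 2) mod 3 = (b + 2) mod 3 \<and> g2 u < g2 v"
       "a * n + u < b * n + v \<longleftrightarrow> a < b \<or> a = b \<and> u < v"
    if "u < n" "v < n" for a b u v
    unfolding G1_def G2_def rotate_blocks_block[OF that(1)] rotate_blocks_block[OF that(2)]
    using r that by (simp_all only: less_block_iff)
  have beats: "majority_beats G1 G2 (a * n + u) (b * n + v) \<longleftrightarrow>
     a = (b + 1) mod 3 \<or> a = b \<and> majority_beats g1 g2 u v"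
    if "a < 3" "b < 3" "u < n" "v < n" for a b u v
    using that(1,2) unfolding majority_beats_def less[OF that(4,3)] lt3
    by (elim disjE) simp_all
  have "\<not> (y < x \<and> G1 y < G1 x \<and> G2 y < G2 x)" if xy: "x < 3 * n" "y < 3 * n" for x y
  proof -
    obtain a u where x: "a < 3" "u < n" "x = a * n + u" using xy(1) by (rule block_cases)
    obtain b v where y: "b < 3" "v < n" "y = b * n + v" using xy(2) by (rule block_cases)
    have "\<not> (v < u \<and> g1 v < g1 u \<and> g2 v < g2 u)"
      using S x y unfolding split_ranking_def by blast
    then show ?thesis
      using x(1) y(1) unfolding x(3) y(3) less[OF y(2) x(2)] lt3
      by (elim disjE) simp_all
  qed
  then show "split_ranking (3 * n) G1 G2"
    using S rotate_blocks_inj[of g1 n 1] rotate_blocks_inj[of g2 n 2]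
    unfolding split_ranking_def G1_def G2_def by simp
  have "(\<Sum>y<3 * n. of_bool (majority_beats G1 G2 (a * n + u) y) :: real)
      = real n + (\<Sum>y<n. of_bool (majority_beats g1 g2 u y))" if au: "a < 3" "u < n" for a u
  proof -
    have "(\<Sum>y<3 * n. of_bool (majority_beats G1 G2 (a * n + u) y) :: real)
        = (\<Sum>b<3. \<Sum>v<n. of_bool (majority_beats G1 G2 (a * n + u) (b * n + v)))"
      unfolding sum.nat_group[symmetric]
    proof (rule sum.cong[OF refl])
      fix b
      show "(\<Sum>y = b * n..<b * n + n. of_bool (majority_beats G1 G2 (a * n + u) y) :: real)
          = (\<Sum>v<n. of_bool (majority_beats G1 G2 (a * n + u) (b * n + v)))"
        by (rule sum.reindex_bij_witness[of _ "\<lambda>v. b * n + v" "\<lambda>y. y - b * n"]) auto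
    qed
    also have "\<dots> = (\<Sum>b<3. \<Sum>v<n. of_bool (a = (b + 1) mod 3 \<or> a = b \<and> majority_beats g1 g2 u v))"
      by (intro sum.cong refl) (simp only: lessThan_iff beats[OF au(1) _ au(2)])
    also have "\<dots> = real n + (\<Sum>v<n. of_bool (majority_beats g1 g2 u v))"
    proof -
      have "{..<3} = {0, 1, 2 :: nat}" by auto
      then show ?thesis using au(1) unfolding lt3 by (elim disjE) (simp_all del: sum_of_bool_eq)
    qed
    finally show ?thesis .
  qed
  note out = this
  show "balanced_upto c (3 * n) G1 G2"
    unfolding balanced_upto_def
  proof (intro allI impI)
    fix x assume "x < 3 * n"
    then obtain a u where x: "a < 3" "u < n" "x = a * n + u" by (rule block_cases)
    have "\<bar>2 * (\<Sum>v<n. of_bool (majority_beats g1 g2 u v)) - (real n - 1)\<bar> \<le> real c"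
      using B x(2) unfolding balanced_upto_def by blast
    then show "\<bar>2 * (\<Sum>y<3 * n. of_bool (majority_beats G1 G2 x y)) - (real (3 * n) - 1)\<bar> \<le> real c"
      unfolding x(3) out[OF x(1,2)] by simp
  qed
qed

text \<open>The iteration starts from a transitive tournament on \<open>s\<close> vertices: \<open>g1\<close> is the identity and \<open>g2\<close>
  its reverse. The factor \<open>s\<close> is at the disposal of divisibility requirements, while the deviation
  \<open>s - 1\<close> becomes negligible against \<open>3 ^ m * s\<close>.\<close>

lemma ex_balanced_ranking:
  assumes "s > 0"
  shows "\<exists>g1 g2. split_ranking (3 ^ m * s) g1 g2 \<and> balanced_upto (s - 1) (3 ^ m * s) g1 g2"
proof (induction m)
  case 0
  have "split_ranking s id (\<lambda>x. s - 1 - x)"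
    using assms by (auto simp: split_ranking_def inj_on_def)
  moreover have out: "(\<Sum>y<s. of_bool (majority_beats id (\<lambda>x. s - 1 - x) x y) :: real) = real x" if "x < s" for x
  proof -
    have "(\<Sum>y<s. of_bool (majority_beats id (\<lambda>x. s - 1 - x) x y) :: real) = (\<Sum>y<s. of_bool (y < x))"
      by (intro sum.cong refl) (auto simp: majority_beats_def)
    also have "\<dots> = real (card ({..<s} \<inter> {y. y < x}))" by simp
    also have "{..<s} \<inter> {y. y < x} = {..<x}" using that by auto
    finally show ?thesis by (simp only: card_lessThan)
  qed
  have "balanced_upto (s - 1) s id (\<lambda>x. s - 1 - x)"
    unfolding balanced_upto_def
  proof (intro allI impI)
    fix x assume x: "x < s"
    then have "\<bar>2 * real x - (real s - 1)\<bar> \<le> real (s - 1)" by linarith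
    then show "\<bar>2 * (\<Sum>y<s. of_bool (majority_beats id (\<lambda>x. s - 1 - x) x y)) - (real s - 1)\<bar> \<le> real (s - 1)"
      unfolding out[OF x] .
  qed
  ultimately show ?case by auto
next
  case (Suc m)
  then obtain g1 g2 where "split_ranking (3 ^ m * s) g1 g2" "balanced_upto (s - 1) (3 ^ m * s) g1 g2"
    by blast
  note triple_blocks[OF this]
  then show ?case unfolding power_Suc mult.assoc by blast
qed

section \<open>Tournaments from rank functions\<close>

definition order_by_rank :: "'a set \<Rightarrow> ('a \<Rightarrow> int) \<Rightarrow> 'a rel" where
  "order_by_rank V f = {(u, v). u \<in> V \<and> v \<in> V \<and> f u < f v}"

lemma strict_linear_order_by_rank:
  assumes "inj_on f V"
  shows "order_by_rank V f \<subseteq> V \<times> V \<and> strict_linear_order_on V (order_by_rank V f)"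
proof -
  have "total_on V (order_by_rank V f)"
  proof (rule total_onI)
    fix x y assume "x \<in> V" "y \<in> V" "x \<noteq> y"
    then have "f x \<noteq> f y" using assms by (auto simp: inj_on_def)
    then show "(x, y) \<in> order_by_rank V f \<or> (y, x) \<in> order_by_rank V f"
      using \<open>x \<in> V\<close> \<open>y \<in> V\<close> by (auto simp: order_by_rank_def)
  qed
  then show ?thesis
    by (auto simp: order_by_rank_def strict_linear_order_on_def trans_def irrefl_def)
qed

definition orders_by_ranks :: "nat \<Rightarrow> 'a set \<Rightarrow> (nat \<Rightarrow> 'a \<Rightarrow> int) \<Rightarrow> 'a rel list" where
  "orders_by_ranks k V r = map (\<lambda>i. order_by_rank V (r i)) [0..<2 * k - 1]"

lemma tournament_by_ranks:
  assumes "k \<ge> 1" "finite V" "V \<noteq> {}" "\<And>i. i < 2 * k - 1 \<Longrightarrow> inj_on (r i) V"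
  shows "weighted_majority_tournament k V (orders_by_ranks k V r)"
proof
  fix R assume "R \<in> set (orders_by_ranks k V r)"
  then obtain i where "i < 2 * k - 1" "R = order_by_rank V (r i)"
    by (auto simp: orders_by_ranks_def)
  then show "R \<subseteq> V \<times> V \<and> strict_linear_order_on V R"
    using strict_linear_order_by_rank[OF assms(4)] by blast
qed (use assms in \<open>simp_all add: orders_by_ranks_def\<close>)

lemma weight_by_ranks:
  assumes T: "weighted_majority_tournament k V (orders_by_ranks k V r)" and "u \<in> V" "v \<in> V"
  shows "weighted_majority_tournament.weight (orders_by_ranks k V r) u v
    = (\<Sum>i<2 * k - 1. of_bool (r i v < r i u))"
proof -
  have "weighted_majority_tournament.weight (orders_by_ranks k V r) u v
    = length (filter (\<lambda>i. r i v < r i u) [0..<2 * k - 1])"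
    unfolding weighted_majority_tournament.weight_def[OF T] unfolding orders_by_ranks_def
    using assms(2,3) by (simp add: filter_map comp_def order_by_rank_def)
  also have "\<dots> = card {i. i < 2 * k - 1 \<and> r i v < r i u}"
    by (auto simp: length_filter_conv_card intro!: arg_cong[of _ _ card])
  also have "\<dots> = card ({..<2 * k - 1} \<inter> {i. r i v < r i u})"
    by (intro arg_cong[of _ _ card]) auto
  finally show ?thesis by simp
qed

text \<open>From the index 3 on, the identity and its reverse alternate and cancel in pairs.\<close>

definition paired_ranks :: "(nat \<Rightarrow> nat) \<Rightarrow> (nat \<Rightarrow> nat) \<Rightarrow> nat \<Rightarrow> nat \<Rightarrow> int" where
  "paired_ranks g1 g2 i x = (if i = 0 then int x else if i = 1 then int (g1 x)
     else if i = 2 then int (g2 x) else if even i then - int x else int x)"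

lemma paired_ranks_inj:
  assumes "split_ranking n g1 g2"
  shows "inj_on (paired_ranks g1 g2 i) {..<n}"
  using assms unfolding split_ranking_def inj_on_def paired_ranks_def by auto

lemma paired_ranks_bounds:
  assumes "split_ranking n g1 g2" "x < n"
  shows "- int n < paired_ranks g1 g2 i x" "paired_ranks g1 g2 i x < int n"
proof -
  have "g1 x < n" "g2 x < n" using assms unfolding split_ranking_def by auto
  then show "- int n < paired_ranks g1 g2 i x" "paired_ranks g1 g2 i x < int n"
    using assms(2) unfolding paired_ranks_def by auto
qed

lemma majority_beats_asym:
  assumes "split_ranking n g1 g2" "x < n" "y < n" "x \<noteq> y"
  shows "majority_beats g1 g2 x y \<longleftrightarrow> \<not> majority_beats g1 g2 y x"
proof -
  have "g1 x \<noteq> g1 y" "g2 x \<noteq> g2 y"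
    using assms unfolding split_ranking_def inj_on_def by auto
  then show ?thesis using assms(4) unfolding majority_beats_def by linarith
qed

lemma majority_beats_irrefl: "\<not> majority_beats g1 g2 x x"
  by (simp add: majority_beats_def)

lemma paired_ranks_count:
  assumes S: "split_ranking n g1 g2" and xy: "x < n" "y < n" "x \<noteq> y" and k: "k > 1"
  shows "(\<Sum>i<2 * k - 1. of_bool (paired_ranks g1 g2 i y < paired_ranks g1 g2 i x))
    = (if majority_beats g1 g2 x y then k else k - 1)"
proof -
  have g: "g1 x \<noteq> g1 y" "g2 x \<noteq> g2 y"
    using assms unfolding split_ranking_def inj_on_def by auto
  have nu: "\<not> (y < x \<and> g1 y < g1 x \<and> g2 y < g2 x)" "\<not> (x < y \<and> g1 x < g1 y \<and> g2 x < g2 y)"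
    using S xy unfolding split_ranking_def by blast+
  have "(\<Sum>i<3 + 2 * j. of_bool (paired_ranks g1 g2 i y < paired_ranks g1 g2 i x))
    = (if majority_beats g1 g2 x y then j + 2 else j + 1)" for j
  proof (induction j)
    case 0
    have "{..<3} = {0, 1, 2 :: nat}" by auto
    then have "(\<Sum>i<3. of_bool (paired_ranks g1 g2 i y < paired_ranks g1 g2 i x))
        = (of_bool (y < x) + of_bool (g1 y < g1 x) + of_bool (g2 y < g2 x) :: nat)"
      by (simp add: paired_ranks_def del: sum_of_bool_eq)
    also have "\<dots> = (if majority_beats g1 g2 x y then 2 else 1)"
      using g nu xy(3) unfolding majority_beats_def
      by (cases "y < x"; cases "g1 y < g1 x"; cases "g2 y < g2 x") auto
    finally show ?case by simp
  next
    case (Suc j)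
    have "{..<3 + 2 * Suc j} = insert (4 + 2 * j) (insert (3 + 2 * j) {..<3 + 2 * j})" by auto
    then have "(\<Sum>i<3 + 2 * Suc j. of_bool (paired_ranks g1 g2 i y < paired_ranks g1 g2 i x))
      = of_bool (x < y) + (of_bool (y < x) +
        (\<Sum>i<3 + 2 * j. of_bool (paired_ranks g1 g2 i y < paired_ranks g1 g2 i x)) :: nat)"
      by (simp add: paired_ranks_def del: sum_of_bool_eq)
    then show ?case unfolding Suc.IH using xy(3) by auto
  qed
  note count = this
  have "3 + 2 * (k - 2) = 2 * k - 1" "k - 2 + 2 = k" "k - 2 + 1 = k - 1" using k by simp_all
  then show ?thesis using count[of "k - 2"] by (simp only:)
qed

text \<open>Old vertices get odd ranks, so that the new vertex \<open>n\<close> can be put into any gap at an even rank. In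
  order 0, which is the identity on the old vertices, it is placed right below the topmost \<open>h\<close> of
  them; in the orders \<open>1, \<dots>, c\<close> it is last and in the others first. Thus \<open>c + 1\<close> orders prefer \<open>u\<close>
  to \<open>n\<close> if \<open>u\<close> is among these \<open>h\<close>, and \<open>c\<close> orders otherwise.\<close>

definition extended_ranks ::
  "nat \<Rightarrow> nat \<Rightarrow> nat \<Rightarrow> (nat \<Rightarrow> nat) \<Rightarrow> (nat \<Rightarrow> nat) \<Rightarrow> nat \<Rightarrow> nat \<Rightarrow> int" where
  "extended_ranks n h c g1 g2 i u =
     (if u < n then 2 * paired_ranks g1 g2 i u + 1
      else if i = 0 then 2 * (int n - int h) else if i \<le> c then - 2 * int n else 2 * int n)"

lemma extended_ranks_inj:
  assumes S: "split_ranking n g1 g2"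
  shows "inj_on (extended_ranks n h c g1 g2 i) {..n}"
proof (rule inj_onI)
  fix u v assume uv: "u \<in> {..n}" "v \<in> {..n}" and eq: "extended_ranks n h c g1 g2 i u = extended_ranks n h c g1 g2 i v"
  have odd: "even (extended_ranks n h c g1 g2 i z) \<longleftrightarrow> \<not> z < n" for z
    by (simp add: extended_ranks_def)
  show "u = v"
  proof (cases "u < n")
    case True
    then have "v < n" using odd eq by metis
    then show ?thesis
      using True eq inj_onD[OF paired_ranks_inj[OF S]] by (simp add: extended_ranks_def)
  next
    case False
    then have "\<not> v < n" using odd eq by metis
    then show ?thesis using False uv by simp
  qed
qed

lemma extended_ranks_count_last:
  assumes S: "split_ranking n g1 g2" and u: "u < n" and "h \<le> n" "c \<le> 2 * k - 2" "k \<ge> 1"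
  shows "(\<Sum>i<2 * k - 1. of_bool (extended_ranks n h c g1 g2 i n < extended_ranks n h c g1 g2 i u))
    = c + of_bool (n - h \<le> u)"
proof -
  have lt: "extended_ranks n h c g1 g2 i n < extended_ranks n h c g1 g2 i u \<longleftrightarrow>
      i \<in> {1..c} \<or> i = 0 \<and> n - h \<le> u" for i
    using paired_ranks_bounds[OF S u, of i] u assms(3)
    by (auto simp: extended_ranks_def paired_ranks_def[of _ _ 0])
  have "{..<2 * k - 1} \<inter> {i. i \<in> {1..c} \<or> i = 0 \<and> n - h \<le> u}
      = {1..c} \<union> (if n - h \<le> u then {0} else {})"
    using assms by auto
  moreover have "card ({1..c} \<union> (if n - h \<le> u then {0} else {})) = c + of_bool (n - h \<le> u)"
    by (subst card_Un_disjoint) auto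
  moreover have "(\<Sum>i<2 * k - 1. of_bool (i \<in> {1..c} \<or> i = 0 \<and> n - h \<le> u))
      = card ({..<2 * k - 1} \<inter> {i. i \<in> {1..c} \<or> i = 0 \<and> n - h \<le> u})"
    by (simp only: sum_of_bool_eq finite_lessThan of_nat_id)
  ultimately show ?thesis unfolding lt by (simp only:)
qed

section \<open>Bounding the maximum approval gap\<close>

context weighted_majority_tournament
begin

lemma finite_dominating: "finite {D. dominating_set D}"
  by (rule finite_subset[of _ "Pow V"]) (auto simp: dominating_set_def finite_V)

text \<open>The condition \<open>0 \<le> q\<close> takes care of the dominating set \<open>V\<close>, whose gap is 0 by convention.\<close>

lemma max_approval_gap_eqI:
  assumes "dominating_set D0" "approval_gap D0 = q" "0 \<le> q"
    and bound: "\<And>D. D \<subseteq> V \<Longrightarrow> D \<noteq> V \<Longrightarrow> D \<noteq> D0 \<Longrightarrow> \<exists>x\<in>V - D. avg_inweight x D \<le> q"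
  shows "max_approval_gap = q"
  unfolding max_approval_gap_def
proof (rule Max_eqI)
  show "finite (approval_gap ` {D. dominating_set D})" using finite_dominating by simp
  show "q \<in> approval_gap ` {D. dominating_set D}" using assms(1,2) by blast
  fix y assume "y \<in> approval_gap ` {D. dominating_set D}"
  then obtain D where D: "dominating_set D" "y = approval_gap D" by blast
  have sub: "D \<subseteq> V" using D(1) by (simp add: dominating_set_def)
  show "y \<le> q"
  proof (cases "D = V \<or> D = D0")
    case True
    then show ?thesis using D(2) assms(2,3) by (cases "D = V") (auto simp: approval_gap_def)
  next
    case False
    then obtain x where x: "x \<in> V - D" "avg_inweight x D \<le> q" using bound sub by blast
    have "approval_gap D \<le> avg_inweight x D"
      using False x(1) finite_V unfolding approval_gap_def by (auto intro!: Min_le)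
    then show ?thesis using x(2) D(2) by linarith
  qed
qed

lemma approval_gap_co_singleton:
  assumes "x \<in> V" "D = V - {x}"
  shows "approval_gap D = avg_inweight x D"
proof -
  have "D \<noteq> V" "V - D = {x}" using assms by auto
  then show ?thesis by (simp add: approval_gap_def)
qed

lemma sum_inweight_eq:
  assumes "finite D"
  shows "(\<Sum>u\<in>{u \<in> D. edge u x}. real (weight u x)) = (\<Sum>u\<in>D. of_bool (edge u x) * real (weight u x))"
  using assms by (simp add: of_bool_def sum.inter_filter if_distrib[of "\<lambda>z. z * _"] cong: if_cong)

lemma avg_inweight_minimal_weights:
  assumes "finite D" "\<And>u. u \<in> D \<Longrightarrow> edge u x \<Longrightarrow> weight u x = k"
  shows "avg_inweight x D = real k * (\<Sum>u\<in>D. of_bool (edge u x)) / real (card D)"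
proof -
  have "(\<Sum>u\<in>{u \<in> D. edge u x}. real (weight u x)) = (\<Sum>u\<in>D. real k * of_bool (edge u x))"
    unfolding sum_inweight_eq[OF assms(1)] by (intro sum.cong refl) (use assms(2) in auto)
  then show ?thesis by (simp only: avg_inweight_def sum_distrib_left)
qed

lemma avg_inweight_le_k:
  assumes "finite D" "\<And>u. u \<in> D \<Longrightarrow> edge u x \<Longrightarrow> weight u x = k"
  shows "avg_inweight x D \<le> real k"
proof -
  have "(\<Sum>u\<in>D. of_bool (edge u x) :: real) \<le> (\<Sum>u\<in>D. 1)"
    by (intro sum_mono) simp
  then have "real k * (\<Sum>u\<in>D. of_bool (edge u x)) \<le> real k * real (card D)"
    by (intro mult_left_mono) (simp_all del: sum_of_bool_eq)
  moreover have "avg_inweight x D = real k * (\<Sum>u\<in>D. of_bool (edge u x)) / real (card D)"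
    using assms by (rule avg_inweight_minimal_weights)
  ultimately show ?thesis
    by (cases "card D = 0") (simp_all add: pos_divide_le_eq del: sum_of_bool_eq)
qed

end

lemma ranks_count_complement:
  fixes r :: "nat \<Rightarrow> 'a \<Rightarrow> int"
  assumes "\<And>i. i < N \<Longrightarrow> r i u \<noteq> r i v"
  shows "(\<Sum>i<N. of_bool (r i v < r i u)) + (\<Sum>i<N. of_bool (r i u < r i v)) = (N :: nat)"
proof -
  have "(\<Sum>i<N. of_bool (r i v < r i u)) + (\<Sum>i<N. of_bool (r i u < r i v)) = (\<Sum>i<N. 1 :: nat)"
    unfolding sum.distrib[symmetric]
  proof (intro sum.cong refl)
    fix i assume "i \<in> {..<N}"
    then have "r i u \<noteq> r i v" using assms by simp
    then show "of_bool (r i v < r i u) + of_bool (r i u < r i v) = (1 :: nat)"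
      by (cases "r i u < r i v") auto
  qed
  then show ?thesis by simp
qed

section \<open>The tournaments attaining a given gap\<close>

text \<open>In the cyclic triangle \<open>ex_rarely_beaten\<close> applies without any error term, hence no gap exceeds
  \<open>k / 2\<close>. Two vertices dominate the third, which is beaten by exactly one of them, and attain it.\<close>

lemma gap_of_three_cycle:
  assumes k: "k > 1"
  shows "\<exists>orders :: nat rel list. weighted_majority_tournament k {..<3} orders \<and>
    weighted_majority_tournament.max_approval_gap k {..<3} orders = real k / 2"
proof -
  obtain g1 g2 where S: "split_ranking 3 g1 g2" and B: "balanced_upto 0 3 g1 g2"
    using ex_balanced_ranking[of 1 1] by auto
  define orders where "orders = orders_by_ranks k {..<3::nat} (paired_ranks g1 g2)"
  have T: "weighted_majority_tournament k {..<3} orders"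
    unfolding orders_def using k paired_ranks_inj[OF S] by (intro tournament_by_ranks) (auto simp: lessThan_empty_iff)
  interpret weighted_majority_tournament k "{..<3}" orders by (rule T)
  have w: "weight u v = (if majority_beats g1 g2 u v then k else k - 1)"
    if "u < 3" "v < 3" "u \<noteq> v" for u v
    using weight_by_ranks[OF T[unfolded orders_def], of u v] paired_ranks_count[OF S that k] that
    unfolding orders_def by (simp del: sum_of_bool_eq)
  have edge: "edge u v \<longleftrightarrow> majority_beats g1 g2 u v" if "u < 3" "v < 3" for u v
    using w[OF that] that k majority_beats_irrefl[of g1 g2 u]
    unfolding edge_def by (cases "u = v") auto
  have wk: "weight u v = k" if "edge u v" for u v
    using that w[of u v] edge[of u v] by (auto simp: edge_def)
  have avg: "avg_inweight x D = real k * (\<Sum>u\<in>D. of_bool (majority_beats g1 g2 u x)) / real (card D)"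
    if "D \<subseteq> {..<3}" "x < 3" for x D
  proof -
    have "finite D" using that(1) finite_subset by blast
    then have "avg_inweight x D = real k * (\<Sum>u\<in>D. of_bool (edge u x)) / real (card D)"
      using wk by (rule avg_inweight_minimal_weights)
    also have "(\<Sum>u\<in>D. of_bool (edge u x) :: real) = (\<Sum>u\<in>D. of_bool (majority_beats g1 g2 u x))"
      using that by (intro sum.cong refl arg_cong[of _ _ of_bool] edge) auto
    finally show ?thesis .
  qed
  have three: "{..<3} = {0, 1, 2 :: nat}" by auto
  have in0: "(\<Sum>u\<in>{1, 2}. of_bool (majority_beats g1 g2 u 0) :: real) = 1"
  proof -
    have "(\<Sum>y<3. of_bool (majority_beats g1 g2 0 y) :: real) = 1"
      using B unfolding balanced_upto_def by (simp del: sum_of_bool_eq)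
    then show ?thesis
      using majority_beats_asym[OF S, of 0 1] majority_beats_asym[OF S, of 0 2] majority_beats_irrefl[of g1 g2 0]
      unfolding three by (simp del: sum_of_bool_eq add: of_bool_def split: if_splits)
  qed
  have "max_approval_gap = real k / 2"
  proof (rule max_approval_gap_eqI)
    have co: "{1, 2} = {..<3} - {0 :: nat}" by auto
    have "majority_beats g1 g2 1 0 \<or> majority_beats g1 g2 2 0"
      using in0 by (rule contrapos_pp) (simp del: sum_of_bool_eq)
    then have "\<exists>u\<in>{1, 2}. edge u 0" using edge[of 1 0] edge[of 2 0] by auto
    moreover have "{..<3} - {1, 2} = {0 :: nat}" by auto
    ultimately show "dominating_set {1, 2}"
      unfolding dominating_set_def by auto
    show "approval_gap {1, 2} = real k / 2"
      using avg[of "{1, 2}" 0] in0 approval_gap_co_singleton[OF _ co] by (simp del: sum_of_bool_eq)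
    show "0 \<le> real k / 2" by simp
    fix D :: "nat set" assume D: "D \<subseteq> {..<3}" "D \<noteq> {..<3}"
    have "\<exists>x\<in>{..<3} - D. (\<Sum>u\<in>D. of_bool (majority_beats g1 g2 u x)) + 0 * of_bool (x \<in> {})
        \<le> (1 / 2 + 0) * (real (card D) + 0)"
    proof (rule ex_rarely_beaten[where c = 0])
      show "D \<subset> {..<3}" using D by blast
      show "majority_beats g1 g2 x y \<longleftrightarrow> \<not> majority_beats g1 g2 y x"
        if "x \<in> {..<3}" "y \<in> {..<3}" "x \<noteq> y" for x y
        using majority_beats_asym[OF S, of x y] that by simp
      show "\<not> majority_beats g1 g2 x x" for x by (rule majority_beats_irrefl)
      show "\<bar>2 * (\<Sum>y<3. of_bool (majority_beats g1 g2 x y)) - (real (card {..<3 :: nat}) - 1)\<bar> \<le> 0"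
        if "x \<in> {..<3}" for x
        using B that unfolding balanced_upto_def by (simp del: sum_of_bool_eq)
    qed simp_all
    then obtain x where x: "x \<in> {..<3} - D"
      "(\<Sum>u\<in>D. of_bool (majority_beats g1 g2 u x)) \<le> real (card D) / 2"
      by (auto simp del: sum_of_bool_eq)
    have "real k * (\<Sum>u\<in>D. of_bool (majority_beats g1 g2 u x)) \<le> real k / 2 * real (card D)"
      using mult_left_mono[OF x(2), of "real k"] by (simp del: sum_of_bool_eq)
    then have "avg_inweight x D \<le> real k / 2"
      using avg[OF D(1), of x] x(1)
      by (cases "card D = 0") (simp_all add: pos_divide_le_eq del: sum_of_bool_eq)
    then show "\<exists>x\<in>{..<3} - D. avg_inweight x D \<le> real k / 2" using x(1) by blast
  qed
  then show ?thesis using T by blast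
qed

text \<open>For \<open>c \<ge> k\<close>, every old vertex has an edge to \<open>n\<close>, of weight \<open>c\<close> or \<open>c + 1\<close>. For \<open>c = k - 1\<close>, the
  topmost \<open>h\<close> old vertices have edges of weight \<open>k\<close> to \<open>n\<close>, and \<open>n\<close> has edges of weight \<open>k\<close> to the
  others. The hypothesis \<open>q\<close> says in both cases that the total inweight of \<open>n\<close> is \<open>q * n\<close>. In either
  case every edge into an old vertex has weight \<open>k\<close>; therefore the alternative \<open>k \<le> q\<close> of \<open>low\<close> suffices,
  and for smaller \<open>q\<close> the other alternative bounds the error in \<open>ex_rarely_beaten\<close> by
  \<open>q / k - 1 / 2\<close>.\<close>

lemma gap_of_extended_ranking:
  assumes S: "split_ranking n g1 g2" and n: "n > 0" and k: "k > 1" and h: "h \<le> n"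
    and c: "k - 1 \<le> c" "c \<le> 2 * k - 2" and hpos: "c = k - 1 \<Longrightarrow> 0 < h"
    and q: "q * real n = (if c = k - 1 then real k * real h else real c * real n + real h)"
    and low: "real k \<le> q \<or> c = k - 1 \<and> s > 0 \<and> balanced_upto (s - 1) n g1 g2
      \<and> real s \<le> (q / real k - 1 / 2) * real n"
  shows "\<exists>orders :: nat rel list. weighted_majority_tournament k {..n} orders \<and>
    weighted_majority_tournament.max_approval_gap k {..n} orders = q"
proof -
  let ?r = "extended_ranks n h c g1 g2"
  define orders where "orders = orders_by_ranks k {..n} ?r"
  have T: "weighted_majority_tournament k {..n} orders"
    unfolding orders_def using k extended_ranks_inj[OF S] by (intro tournament_by_ranks) auto
  interpret weighted_majority_tournament k "{..n}" orders by (rule T)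
  have count: "weight u v = (\<Sum>i<2 * k - 1. of_bool (?r i v < ?r i u))" if "u \<le> n" "v \<le> n" for u v
    using weight_by_ranks[OF T[unfolded orders_def], of u v] that unfolding orders_def by simp
  have w: "weight u v = (if majority_beats g1 g2 u v then k else k - 1)"
    if "u < n" "v < n" "u \<noteq> v" for u v
  proof -
    have "weight u v = (\<Sum>i<2 * k - 1. of_bool (paired_ranks g1 g2 i v < paired_ranks g1 g2 i u))"
      unfolding count[OF less_imp_le[OF that(1)] less_imp_le[OF that(2)]]
      using that by (intro sum.cong refl) (simp add: extended_ranks_def)
    then show ?thesis using paired_ranks_count[OF S that k] by simp
  qed
  have w_last: "weight u n = c + of_bool (n - h \<le> u)" if "u < n" for u
    using count[of u n] extended_ranks_count_last[OF S that h c(2)] that k by simp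
  have last_w: "weight n u = 2 * k - 1 - (c + of_bool (n - h \<le> u))" if "u < n" for u
  proof -
    have "?r i n \<noteq> ?r i u" for i
      using inj_onD[OF extended_ranks_inj[OF S], of h c i n u] that by auto
    then have "weight n u + weight u n = 2 * k - 1"
      unfolding count[OF order_refl less_imp_le[OF that]] count[OF less_imp_le[OF that] order_refl]
      by (rule ranks_count_complement)
    then show ?thesis using w_last[OF that] by simp
  qed
  have edge: "edge u v \<longleftrightarrow> majority_beats g1 g2 u v" if "u < n" "v < n" for u v
    using w[OF that] that k majority_beats_irrefl[of g1 g2 u]
    unfolding edge_def by (cases "u = v") auto
  have edge_last: "edge u n \<longleftrightarrow> k \<le> c + of_bool (n - h \<le> u)" if "u < n" for u
    using w_last[OF that] that unfolding edge_def by simp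
  have last_edge: "edge n u \<longleftrightarrow> c = k - 1 \<and> u < n - h" if "u < n" for u
    using last_w[OF that] that c k unfolding edge_def by (cases "n - h \<le> u") auto
  have wk: "weight u v = k" if "v < n" "edge u v" for u v
  proof (cases "u < n")
    case True
    then show ?thesis using that w[OF True that(1)] edge[OF True that(1)] by (auto simp: edge_def)
  next
    case False
    then have "u = n" using that(2) by (simp add: edge_def)
    then show ?thesis using last_w[OF that(1)] last_edge[OF that(1)] that(2) k by auto
  qed
  have "0 \<le> q * real n" unfolding q by simp
  then have q0: "0 \<le> q" using n by (simp add: zero_le_mult_iff)
  have gap: "avg_inweight n {..<n} = q"
  proof -
    have top: "{..<n} \<inter> {u. n - h \<le> u} = {n - h..<n}" by auto
    have H: "(\<Sum>u<n. of_bool (n - h \<le> u) :: real) = real h"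
      using h by (simp add: top)
    have "(\<Sum>u\<in>{u \<in> {..<n}. edge u n}. real (weight u n)) = (\<Sum>u<n. of_bool (edge u n) * real (weight u n))"
      by (rule sum_inweight_eq) simp
    also have "\<dots> = (\<Sum>u<n. if c = k - 1 then real k * of_bool (n - h \<le> u) else real c + of_bool (n - h \<le> u))"
    proof (rule sum.cong[OF refl])
      fix u assume "u \<in> {..<n}"
      then have u: "u < n" by simp
      show "of_bool (edge u n) * real (weight u n)
        = (if c = k - 1 then real k * of_bool (n - h \<le> u) else real c + of_bool (n - h \<le> u))"
        unfolding edge_last[OF u] w_last[OF u] using c(1) k by (cases "n - h \<le> u") auto
    qed
    also have "\<dots> = q * real n"
      unfolding q using H
      by (cases "c = k - 1") (simp_all add: sum.distrib sum_distrib_left[symmetric] del: sum_of_bool_eq)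
    finally show ?thesis unfolding avg_inweight_def using n by simp
  qed
  have "max_approval_gap = q"
  proof (rule max_approval_gap_eqI)
    have co: "{..<n} = {..n} - {n}" by auto
    have "edge (n - 1) n"
      using edge_last[of "n - 1"] n k c(1) hpos by (cases "c = k - 1") auto
    then show "dominating_set {..<n}"
      unfolding dominating_set_def using n by (auto intro!: bexI[of _ "n - 1"] simp: le_less)
    show "approval_gap {..<n} = q"
      using approval_gap_co_singleton[OF _ co] gap by simp
    show "0 \<le> q" by (rule q0)
    fix D assume D: "D \<subseteq> {..n}" "D \<noteq> {..n}" "D \<noteq> {..<n}"
    define D' where "D' = D \<inter> {..<n}"
    have D_eq: "D = (if n \<in> D then insert n D' else D')"
      unfolding D'_def using D(1) by (auto simp: le_less)
    have D': "D' \<subset> {..<n}"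
    proof (rule psubsetI)
      show "D' \<subseteq> {..<n}" by (simp add: D'_def)
      show "D' \<noteq> {..<n}"
      proof
        assume "D' = {..<n}"
        moreover have "{..n} = insert n {..<n}" by auto
        ultimately show False using D_eq D(2,3) by (auto split: if_splits)
      qed
    qed
    have fin: "finite D" "finite D'" using D(1) D' by (auto intro: finite_subset)
    show "\<exists>x\<in>{..n} - D. avg_inweight x D \<le> q"
      using low
    proof
      assume "real k \<le> q"
      obtain x where x: "x < n" "x \<notin> D'" using D' by blast
      have "avg_inweight x D \<le> real k"
        using fin(1) wk[OF x(1)] by (rule avg_inweight_le_k)
      then show ?thesis using x \<open>real k \<le> q\<close> by (intro bexI[of _ x]) (auto simp: D'_def)
    next
      assume A: "c = k - 1 \<and> s > 0 \<and> balanced_upto (s - 1) n g1 g2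
        \<and> real s \<le> (q / real k - 1 / 2) * real n"
      then have bal: "balanced_upto (s - 1) n g1 g2" by blast
      define \<tau> where "\<tau> = (of_bool (n \<in> D) :: real)"
      define e where "e = q / real k - 1 / 2"
      have "0 < e * real n" using A unfolding e_def by linarith
      then have e: "0 \<le> e" using n by (simp add: zero_less_mult_iff)
      \<comment> \<open>As \<open>q \<ge> k / 2\<close>, at least half of the old vertices beat \<open>n\<close>, so \<open>n\<close> beats at most half.\<close>
      have "real n * real k \<le> 2 * (q * real n)"
        using e k n unfolding e_def by (simp add: field_simps)
      then have "real k * real n \<le> real k * (2 * real h)"
        using A unfolding q by (simp add: algebra_simps)
      then have "real n \<le> 2 * real h" using k by simp
      then have H: "2 * card {..<n - h} \<le> card {..<n}" by simp
      \<comment> \<open>\<open>{..<n - h}\<close> is the set of vertices beaten by \<open>n\<close>.\<close>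
      have "\<exists>x\<in>{..<n} - D'. (\<Sum>u\<in>D'. of_bool (majority_beats g1 g2 u x)) + \<tau> * of_bool (x \<in> {..<n - h})
          \<le> (1 / 2 + e) * (real (card D') + \<tau>)"
      proof (rule ex_rarely_beaten)
        show "\<bar>2 * (\<Sum>y<n. of_bool (majority_beats g1 g2 x y)) - (real (card {..<n}) - 1)\<bar> \<le> real (s - 1)"
          if "x \<in> {..<n}" for x
          using bal that unfolding balanced_upto_def by simp
        have "\<tau> \<le> 1" by (simp add: \<tau>_def)
        moreover have "real (s - 1) = real s - 1" using A by (simp add: of_nat_diff)
        moreover have "real s \<le> e * real n" using A unfolding e_def by simp
        ultimately show "real (s - 1) + \<tau> \<le> e * real (card {..<n})" by simp
        show "majority_beats g1 g2 x y \<longleftrightarrow> \<not> majority_beats g1 g2 y x"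
          if "x \<in> {..<n}" "y \<in> {..<n}" "x \<noteq> y" for x y
          using majority_beats_asym[OF S, of x y] that by simp
        show "\<not> majority_beats g1 g2 x x" for x by (rule majority_beats_irrefl)
        show "D' \<subset> {..<n}" by (rule D')
        show "2 * card {..<n - h} \<le> card {..<n}" by (rule H)
        show "0 \<le> e" by (rule e)
      qed (simp_all add: \<tau>_def)
      then obtain x where x: "x < n" "x \<notin> D'" and le: "(\<Sum>u\<in>D'. of_bool (majority_beats g1 g2 u x)) + \<tau> * of_bool (x < n - h)
          \<le> (1 / 2 + e) * (real (card D') + \<tau>)"
        by (auto simp del: sum_of_bool_eq)
      have "(\<Sum>u\<in>D. of_bool (edge u x) :: real) = (\<Sum>u\<in>D'. of_bool (edge u x)) + \<tau> * of_bool (edge n x)"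
        using fin(2) by (subst D_eq) (simp add: \<tau>_def D'_def del: sum_of_bool_eq)
      also have "(\<Sum>u\<in>D'. of_bool (edge u x) :: real) = (\<Sum>u\<in>D'. of_bool (majority_beats g1 g2 u x))"
        using D' by (intro sum.cong refl arg_cong[of _ _ of_bool] edge x(1)) auto
      also have "edge n x \<longleftrightarrow> x < n - h" using last_edge[OF x(1)] A by simp
      finally have sum_le: "(\<Sum>u\<in>D. of_bool (edge u x)) \<le> q / real k * (real (card D') + \<tau>)"
        using le unfolding e_def by simp
      have "real (card D) = real (card D') + \<tau>"
        using fin(2) by (subst D_eq) (simp add: \<tau>_def D'_def)
      then have "real k * (\<Sum>u\<in>D. of_bool (edge u x)) \<le> q * real (card D)"
        using mult_left_mono[OF sum_le, of "real k"] k by simp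
      moreover have "avg_inweight x D = real k * (\<Sum>u\<in>D. of_bool (edge u x)) / real (card D)"
        using fin(1) wk[OF x(1)] by (rule avg_inweight_minimal_weights)
      ultimately have "avg_inweight x D \<le> q"
        using q0 by (cases "card D = 0") (simp_all add: pos_divide_le_eq del: sum_of_bool_eq)
      then show ?thesis using x by (intro bexI[of _ x]) (auto simp: D'_def)
    qed
  qed
  then show ?thesis using T by blast
qed

lemma rational_multiple:
  fixes q :: real
  assumes "q \<in> \<rat>" "q > 0"
  obtains a b :: nat where "b > 0" "q * real b = real a"
proof -
  obtain a b :: nat where "b \<noteq> 0" "\<bar>q\<bar> = real a / real b"
    using Rats_abs_nat_div_natE[OF assms(1)] by metis
  then show ?thesis using that[of b a] assms(2) by simp
qed

theorem theorem6:
  fixes k :: nat and q :: real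
  assumes "k > 1"
    and "q \<in> \<rat>"
    and "real k / 2 \<le> q"
    and "q \<le> 2 * real k - 1"
  shows "\<exists>(V :: nat set) (orders :: nat rel list).
    weighted_majority_tournament k V orders \<and>
    weighted_majority_tournament.max_approval_gap k V orders = q"
proof -
  have q: "q > 0" using assms(1,3) by simp
  obtain a b :: nat where b: "b > 0" "q * real b = real a"
    using rational_multiple[OF assms(2) q] .
  consider "q = real k / 2" | "real k / 2 < q" "q < real k" | "real k \<le> q"
    using assms(3) by linarith
  then show ?thesis
  proof cases
    case 1
    then show ?thesis using gap_of_three_cycle[OF assms(1)] by blast
  next
    case 2
    define e where "e = q / real k - 1 / 2"
    have e: "e > 0" using 2 assms(1) unfolding e_def by (simp add: field_simps)
    obtain m where "1 / e < 3 ^ m" using real_arch_pow[of 3 "1 / e"] by auto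
    then have m: "1 \<le> e * 3 ^ m" using e by (simp add: field_simps)
    \<comment> \<open>The factors \<open>k\<close> and \<open>b\<close> of \<open>s\<close> make \<open>q * n / k\<close> an integer, namely \<open>h\<close>.\<close>
    define s where "s = k * b"
    define n where "n = 3 ^ m * s"
    define h where "h = 3 ^ m * a"
    have s: "s > 0" using b assms(1) by (simp add: s_def)
    obtain g1 g2 where g: "split_ranking n g1 g2" "balanced_upto (s - 1) n g1 g2"
      unfolding n_def using ex_balanced_ranking[OF s] by blast
    have qn: "q * real n = real k * real h"
      unfolding n_def s_def h_def using b(2) by (simp add: algebra_simps)
    have "n > 0" using s by (simp add: n_def)
    have "real k * real h \<le> real k * real n"
      using qn 2 by (metis less_imp_le mult_right_mono of_nat_0_le_iff)
    then have "h \<le> n" using assms(1) by simp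
    have "h > 0" using b q by (cases a) (auto simp: h_def)
    have "real s \<le> e * 3 ^ m * real s" using mult_right_mono[OF m, of "real s"] by simp
    then have "real s \<le> (q / real k - 1 / 2) * real n"
      unfolding e_def n_def by (simp add: algebra_simps)
    then have "\<exists>orders. weighted_majority_tournament k {..n} orders \<and>
        weighted_majority_tournament.max_approval_gap k {..n} orders = q"
      using \<open>h > 0\<close> qn s g(2)
      by (intro gap_of_extended_ranking[OF g(1) \<open>n > 0\<close> assms(1) \<open>h \<le> n\<close>, of "k - 1" q s]) auto
    then show ?thesis by blast
  next
    case 3
    obtain g1 g2 where g: "split_ranking b g1 g2"
      using ex_balanced_ranking[OF b(1), of 0] by auto
    \<comment> \<open>The minimum matters for \<open>q = 2 * k - 1\<close> only: there \<open>c + 1 = q\<close> and \<open>h = b\<close>.\<close>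
    define c where "c = min (nat \<lfloor>q\<rfloor>) (2 * k - 2)"
    define h where "h = a - c * b"
    have "int k \<le> \<lfloor>q\<rfloor>" using 3 by (simp add: le_floor_iff)
    then have kc: "k \<le> c" "c \<le> 2 * k - 2"
      using assms(1) unfolding c_def by auto
    have cq: "real c \<le> q" "q \<le> real c + 1"
    proof -
      have "real (nat \<lfloor>q\<rfloor>) \<le> q" "q \<le> real (nat \<lfloor>q\<rfloor>) + 1"
        using q by (linarith, linarith)
      moreover have "real (2 * k - 2) = 2 * real k - 2" using assms(1) by (simp add: of_nat_diff)
      ultimately show "real c \<le> q" "q \<le> real c + 1"
        using assms(4) unfolding c_def by linarith+
    qed
    have "real c * real b \<le> real a" "real a \<le> (real c + 1) * real b"
      unfolding b(2)[symmetric] using cq by (simp_all add: mult_right_mono)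
    then have "real (c * b) \<le> real a" "real a \<le> real ((c + 1) * b)" by (simp_all add: algebra_simps)
    then have ab: "c * b \<le> a" "a \<le> (c + 1) * b" unfolding of_nat_le_iff .
    then have hb: "h \<le> b" "q * real b = real c * real b + real h"
      unfolding h_def b(2) by (simp_all add: of_nat_diff)
    have "\<exists>orders. weighted_majority_tournament k {..b} orders \<and>
        weighted_majority_tournament.max_approval_gap k {..b} orders = q"
      using kc hb 3 assms(1)
      by (intro gap_of_extended_ranking[OF g b(1) assms(1) hb(1), of c]) auto
    then show ?thesis by blast
  qed
qed

end
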